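(* Let $\Omega\subset\mathbb{R}^d$ be a bounded domain with $\mathcal C^2$ boundary, let $F,G:\bar\Omega\times\mathbb{R}^d\to\mathbb{R}^d$ and $U_0:\bar\Omega\to\mathbb{R}^d$. Assume that $\langle F(q,V),\eta(q)\rangle\ge 0$ for all $q\in\partial\Omega$, $V\in\mathbb{R}^d$, where $\eta(q)$ is the unit outward normal vector to $\partial\Omega$ at $q$. Assume that $(G,F):\bar\Omega\times\mathbb{R}^d\to\mathbb{R}^{2d}$ is monotone and that $U_0:\bar\Omega\to\mathbb{R}^d$ is monotone. Then there exists at most one M-solution $U:[0,\infty)\times\bar\Omega\to\mathbb{R}^d$ of $$\partial_tU(t,q)+\langle F(q,U(t,q)),\nabla_q\rangle U(t,q)=G(q,U(t,q))\quad\text{in }(0,\infty)\times\bar\Omega$$ with initial condition $U|_{t=0}=U_0$. Moreover, if such a solution $U$ exists, then for all $t\ge0$, $U(t,\cdot)$ is a monotone map.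
   Context: $\langle\cdot,\cdot\rangle$ is the Euclidean scalar product. A map $\phi:\bar\Omega\to\mathbb{R}^d$ is monotone if $\langle\phi(q)-\phi(p),q-p\rangle\ge0$ for all $q,p\in\bar\Omega$. The pair $(G,F)$ is monotone if $\langle G(q,u)-G(p,v),q-p\rangle+\langle F(q,u)-F(p,v),u-v\rangle\ge0$ for all $q,p\in\bar\Omega$, $u,v\in\mathbb{R}^d$. A continuous function $U:\mathbb{R}_+\times\bar\Omega\to\mathbb{R}^d$ is called an M-solution of the equation if for all $T>0$, $V\in\mathbb{R}^d$, $p\in\bar\Omega$, $\vartheta\in\mathcal C^1(\mathbb{R})$ and every $(t_*,q_* )\in(0,T]\times\bar\Omega$ which is a point of strict minimum of $(t,q)\mapsto\langle U(t,q)-V,q-p\rangle-\vartheta(t)$ on $[0,T]\times\bar\Omega$, one has $$\vartheta'(t_* )\ge\langle G(q_*,U(t_*,q_* )),q_*-p\rangle+\langle F(q_*,U(t_*,q_* )),U(t_*,q_* )-V\rangle.$$ *)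

theory Defs
  imports "HOL-Analysis.Analysis"
begin

definition C2_with_gradient_on ::
    "'a::euclidean_space set \<Rightarrow> ('a \<Rightarrow> real) \<Rightarrow> ('a \<Rightarrow> 'a) \<Rightarrow> bool" where
  "C2_with_gradient_on N \<rho> g \<longleftrightarrow>
     (\<forall>x\<in>N. GDERIV \<rho> x :> g x) \<and>
     (\<exists>H :: 'a \<Rightarrow> 'a \<Rightarrow>\<^sub>L 'a.
        (\<forall>x\<in>N. (g has_derivative blinfun_apply (H x)) (at x)) \<and> continuous_on N H)"

text \<open>
  The boundary is described near \<open>q\<close> by a \<open>C\<^sup>2\<close> function \<open>\<rho>\<close> with nonvanishing gradient \<open>g\<close>.
  The sign convention (\<open>\<rho> < 0\<close> exactly inside \<open>\<Omega>\<close>) says that \<open>\<Omega>\<close> lies locally on one side of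
  its boundary and makes \<open>g\<close> point outward.
\<close>

definition local_defining_function ::
    "'a::euclidean_space set \<Rightarrow> 'a \<Rightarrow> 'a set \<Rightarrow> ('a \<Rightarrow> real) \<Rightarrow> ('a \<Rightarrow> 'a) \<Rightarrow> bool" where
  "local_defining_function \<Omega> q N \<rho> g \<longleftrightarrow>
     open N \<and> q \<in> N \<and> C2_with_gradient_on N \<rho> g \<and> (\<forall>x\<in>N. g x \<noteq> 0) \<and>
     \<Omega> \<inter> N = {x\<in>N. \<rho> x < 0} \<and> frontier \<Omega> \<inter> N = {x\<in>N. \<rho> x = 0}"

definition C2_boundary :: "'a::euclidean_space set \<Rightarrow> bool" where
  "C2_boundary \<Omega> \<longleftrightarrow> (\<forall>q\<in>frontier \<Omega>. \<exists>N \<rho> g. local_defining_function \<Omega> q N \<rho> g)"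

text \<open>
  The description below is unique by \<open>outward_unit_normal_eq\<close>, so the value does not depend on
  the choice of the defining function. It is meaningful only at boundary points.
\<close>

definition outward_unit_normal :: "'a::euclidean_space set \<Rightarrow> 'a \<Rightarrow> 'a" where
  "outward_unit_normal \<Omega> q =
     (THE n. \<exists>N \<rho> g. local_defining_function \<Omega> q N \<rho> g \<and> n = g q /\<^sub>R norm (g q))"

definition monotone_map_on :: "'a::real_inner set \<Rightarrow> ('a \<Rightarrow> 'a) \<Rightarrow> bool" where
  "monotone_map_on S \<phi> \<longleftrightarrow> (\<forall>q\<in>S. \<forall>p\<in>S. (\<phi> q - \<phi> p) \<bullet> (q - p) \<ge> 0)"

definition monotone_pair_on ::
    "'a::real_inner set \<Rightarrow> ('a \<Rightarrow> 'a \<Rightarrow> 'a) \<Rightarrow> ('a \<Rightarrow> 'a \<Rightarrow> 'a) \<Rightarrow> bool" where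
  "monotone_pair_on S G F \<longleftrightarrow>
     (\<forall>q\<in>S. \<forall>p\<in>S. \<forall>u v. (G q u - G p v) \<bullet> (q - p) + (F q u - F p v) \<bullet> (u - v) \<ge> 0)"

definition strict_min_point :: "'b set \<Rightarrow> ('b \<Rightarrow> real) \<Rightarrow> 'b \<Rightarrow> bool" where
  "strict_min_point S f x \<longleftrightarrow> x \<in> S \<and> (\<forall>y\<in>S. y \<noteq> x \<longrightarrow> f x < f y)"

text \<open>
  M-solutions on \<open>[0,\<infinity>) \<times> closure \<Omega>\<close> of \<open>\<partial>\<^sub>tU + \<langle>F(q,U),\<nabla>\<^sub>q\<rangle>U = G(q,U)\<close>. Only values of \<open>U\<close> at
  \<open>t \<ge> 0\<close> and \<open>q \<in> closure \<Omega>\<close> matter; the initial condition is not part of the notion.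
\<close>

definition M_solution ::
    "'a::euclidean_space set \<Rightarrow> ('a \<Rightarrow> 'a \<Rightarrow> 'a) \<Rightarrow> ('a \<Rightarrow> 'a \<Rightarrow> 'a) \<Rightarrow> (real \<Rightarrow> 'a \<Rightarrow> 'a) \<Rightarrow> bool" where
  "M_solution \<Omega> F G U \<longleftrightarrow>
     continuous_on ({0..} \<times> closure \<Omega>) (\<lambda>(t, q). U t q) \<and>
     (\<forall>T>0. \<forall>V. \<forall>p\<in>closure \<Omega>. \<forall>\<theta>. \<theta> C1_differentiable_on UNIV \<longrightarrow>
       (\<forall>t\<in>{0<..T}. \<forall>q\<in>closure \<Omega>.
          strict_min_point ({0..T} \<times> closure \<Omega>) (\<lambda>(s, x). (U s x - V) \<bullet> (x - p) - \<theta> s) (t, q) \<longrightarrow>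
          deriv \<theta> t \<ge> G q (U t q) \<bullet> (q - p) + F q (U t q) \<bullet> (U t q - V)))"

lemma local_defining_function_normal_unique:
  fixes \<Omega> :: "'a::euclidean_space set"
  assumes q: "q \<in> frontier \<Omega>"
    and 1: "local_defining_function \<Omega> q N1 \<rho>1 g1"
    and 2: "local_defining_function \<Omega> q N2 \<rho>2 g2"
  shows "g1 q /\<^sub>R norm (g1 q) = g2 q /\<^sub>R norm (g2 q)" (is "?n1 = ?n2")
proof (rule ccontr)
  assume ne: "?n1 \<noteq> ?n2"
  have nz: "g1 q \<noteq> 0" "g2 q \<noteq> 0"
    using 1 2 by (auto simp: local_defining_function_def)
  define n1 n2 where n: "n1 = ?n1" "n2 = ?n2"
  define v where "v = n2 - n1"
  have unit: "n1 \<bullet> n1 = 1" "n2 \<bullet> n2 = 1"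
    using nz unfolding n norm_eq_1[symmetric] by simp_all
  have "0 < (n1 - n2) \<bullet> (n1 - n2)"
    using ne by (simp add: n)
  then have "n1 \<bullet> n2 < 1"
    using unit by (simp add: inner_diff_left inner_diff_right inner_commute)
  then have "n1 \<bullet> v < 0" "n2 \<bullet> v > 0"
    using unit by (simp_all add: v_def inner_diff_right inner_commute)
  moreover have "n1 \<bullet> v = (g1 q \<bullet> v) / norm (g1 q)" "n2 \<bullet> v = (g2 q \<bullet> v) / norm (g2 q)"
    by (simp_all only: n inner_scaleR_left divide_inverse mult.commute)
  ultimately have sgn: "g1 q \<bullet> v < 0" "g2 q \<bullet> v > 0"
    using nz by (simp_all add: zero_less_divide_iff divide_less_0_iff)
  have line: "DERIV (\<lambda>t. \<rho> (q + t *\<^sub>R v)) 0 :> g q \<bullet> v"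
    if "local_defining_function \<Omega> q N \<rho> g" for N \<rho> g
  proof -
    have outer: "(\<rho> has_derivative (\<lambda>h. h \<bullet> g q)) (at (q + 0 *\<^sub>R v))"
      using that by (simp add: local_defining_function_def C2_with_gradient_on_def gderiv_def)
    have inner: "((\<lambda>t. q + t *\<^sub>R v) has_derivative (\<lambda>t. t *\<^sub>R v)) (at 0)"
      by (auto intro!: derivative_eq_intros)
    have "((\<lambda>t. \<rho> (q + t *\<^sub>R v)) has_derivative (\<lambda>t. (t *\<^sub>R v) \<bullet> g q)) (at 0)"
      using has_derivative_compose[OF inner, of \<rho> "\<lambda>h. h \<bullet> g q"] outer by simp
    then show ?thesis
      by (simp add: has_field_derivative_def inner_commute[of v] mult_commute_abs)
  qed
  have "\<rho>1 q = 0" "\<rho>2 q = 0"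
    using q 1 2 by (auto simp: local_defining_function_def)
  then obtain d1 d2 where d: "d1 > 0" "d2 > 0"
    and neg: "\<And>h. 0 < h \<Longrightarrow> h < d1 \<Longrightarrow> \<rho>1 (q + h *\<^sub>R v) < 0"
    and pos: "\<And>h. 0 < h \<Longrightarrow> h < d2 \<Longrightarrow> \<rho>2 (q + h *\<^sub>R v) > 0"
    using DERIV_neg_dec_right[OF line[OF 1] sgn(1)] DERIV_pos_inc_right[OF line[OF 2] sgn(2)]
    by auto
  have N: "open (N1 \<inter> N2)" "q \<in> N1 \<inter> N2"
    using 1 2 by (auto simp: local_defining_function_def)
  have lim: "((\<lambda>h. q + h *\<^sub>R v) \<longlongrightarrow> q) (at_right (0::real))"
    by (auto intro!: tendsto_eq_intros)
  have "eventually (\<lambda>h. q + h *\<^sub>R v \<in> N1 \<inter> N2) (at_right (0::real))"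
    by (rule topological_tendstoD[OF lim N])
  moreover have "eventually (\<lambda>h. h \<in> {0<..<min d1 d2}) (at_right (0::real))"
    using d by (intro eventually_at_right_real) auto
  ultimately have "eventually (\<lambda>h. q + h *\<^sub>R v \<in> N1 \<inter> N2 \<and> h \<in> {0<..<min d1 d2}) (at_right (0::real))"
    by (rule eventually_conj)
  then obtain h where h: "q + h *\<^sub>R v \<in> N1 \<inter> N2" "h \<in> {0<..<min d1 d2}"
    using eventually_happens'[OF trivial_limit_at_right_real] by blast
  then have "\<rho>1 (q + h *\<^sub>R v) < 0" "\<not> \<rho>2 (q + h *\<^sub>R v) < 0"
    using neg[of h] pos[of h] by simp_all
  moreover have "\<Omega> \<inter> N1 = {x\<in>N1. \<rho>1 x < 0}" "\<Omega> \<inter> N2 = {x\<in>N2. \<rho>2 x < 0}"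
    using 1 2 by (simp_all add: local_defining_function_def)
  ultimately show False using h(1) by blast
qed

lemma outward_unit_normal_eq:
  assumes "q \<in> frontier \<Omega>" "local_defining_function \<Omega> q N \<rho> g"
  shows "outward_unit_normal \<Omega> q = g q /\<^sub>R norm (g q)"
  unfolding outward_unit_normal_def
proof (rule the_equality)
  show "\<exists>N \<rho> g'. local_defining_function \<Omega> q N \<rho> g' \<and> g q /\<^sub>R norm (g q) = g' q /\<^sub>R norm (g' q)"
    using assms(2) by blast
next
  fix n assume "\<exists>N \<rho> g'. local_defining_function \<Omega> q N \<rho> g' \<and> n = g' q /\<^sub>R norm (g' q)"
  then show "n = g q /\<^sub>R norm (g q)"
    using local_defining_function_normal_unique[OF assms(1) _ assms(2)] by auto
qed

end

theory Submission
  imports Defs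
begin

text \<open>
  Both conclusions follow from one comparison principle: if \<open>U\<close> and \<open>W\<close> are M-solutions with
  \<open>\<langle>U(0,q) - W(0,p), q - p\<rangle> \<ge> 0\<close> for all \<open>q, p\<close>, then \<open>\<langle>U(t,q) - W(t,p), q - p\<rangle> \<ge> 0\<close> at all
  later times. With \<open>W = U\<close> this says that \<open>U(t,\<cdot>)\<close> is monotone. For two solutions with the same
  initial value, letting \<open>q\<close> tend to an interior point \<open>p\<close> from an arbitrary direction gives
  \<open>U(t,p) = W(t,p)\<close>.

  The comparison is a doubling of variables. Suppose the inequality fails at time \<open>T\<close> and minimise
  \<open>f = \<langle>U(t,q) - W(s,p), q - p\<rangle> + k(t - s)\<^sup>2 + \<gamma>(t + s)\<close> with \<open>\<gamma>\<close> small and \<open>k\<close> large; the minimum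
  is attained at positive times. In \<open>(t,q)\<close> alone, \<open>f\<close> is an expression of the kind tested in the
  definition, with \<open>V = W(s,p)\<close>; in \<open>(s,p)\<close> alone the same is true with the roles exchanged. If
  both minima were strict, adding the two inequalities would give \<open>-2\<gamma>\<close> on the upper side and the
  monotonicity of \<open>(G,F)\<close> on the lower side, which is absurd.

  The difficulty is strictness. A perturbation linear in \<open>q\<close> shifts the vector \<open>V\<close> and costs a term
  \<open>\<langle>F(q,U), a\<rangle>\<close>, and \<open>F\<close> and \<open>G\<close> may be discontinuous and unbounded near the boundary. The cost is
  absorbed by moving the base points as well. Instead of \<open>p\<close>, use \<open>(1-\<beta>)p + \<beta>y\<close> in the test for
  \<open>U\<close>, where \<open>y\<close> is fixed, and similarly \<open>(1-\<beta>)q + \<beta>z\<close> in the test for \<open>W\<close>. Up to the factor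
  \<open>1-\<beta>\<close> on the monotone part, all new terms then combine into
  \<open>\<beta>(\<langle>G(q,U), q - y\<rangle> + \<langle>F(q,U), U - w\<rangle>)\<close> with \<open>w\<close> bounded, and monotonicity against the values
  of \<open>(G,F)\<close> over the single point \<open>y\<close> bounds this below by \<open>-\<beta>C\<close>
  (\<open>monotone_pair_lower_bound\<close>). As \<open>\<beta>\<close> tends to zero, \<open>\<gamma> \<le> 0\<close> results.

  Two things make this admissible. The shifted base points have to stay in the closed domain,
  which holds for suitable \<open>y\<close> and \<open>z\<close> as long as \<open>p\<close> and \<open>q\<close> stay near given points
  (\<open>C2_boundary_locally_starshaped\<close>). The minimum has to be strict and near given points: both are
  achieved by the concave perturbation \<open>-\<beta>L\<bar>x + x\<^sub>0\<bar>\<^sup>2\<close> in the doubled variable \<open>x\<close>, where \<open>x\<^sub>0\<close> is a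
  minimum point of \<open>f\<close> of largest norm. Since the perturbation is concave, replacing it by its
  tangent keeps the minimum point and makes it strict, so only linear terms enter the tests.
\<close>

section \<open>Local star-shapedness of a smooth domain\<close>

text \<open>
  Move from a boundary point \<open>p0\<close> slightly against the gradient of the defining function to
  get \<open>y\<close>. Near \<open>p0\<close> the gradient is almost constant, so the defining function decreases along every
  segment from a nearby point towards \<open>y\<close>, and the segment cannot leave the closed domain.
\<close>

lemma C2_boundary_locally_starshaped:
  fixes \<Omega> :: "'a::euclidean_space set"
  assumes "open \<Omega>" "C2_boundary \<Omega>" "p0 \<in> closure \<Omega>"
  obtains y r where "y \<in> closure \<Omega>" "r > 0"
    "\<And>p b. p \<in> closure \<Omega> \<Longrightarrow> dist p p0 < r \<Longrightarrow> 0 \<le> b \<Longrightarrow> b \<le> 1 \<Longrightarrow>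
       (1 - b) *\<^sub>R p + b *\<^sub>R y \<in> closure \<Omega>"
proof (cases "p0 \<in> \<Omega>")
  case True
  then obtain r where r: "r > 0" "ball p0 r \<subseteq> \<Omega>"
    using assms(1) open_contains_ball by blast
  show thesis
  proof
    show "p0 \<in> closure \<Omega>" "r > 0" using assms r by auto
    fix p b assume "dist p p0 < r" "(0::real) \<le> b" "b \<le> 1"
    then have "(1 - b) *\<^sub>R p + b *\<^sub>R p0 \<in> ball p0 r"
      using r by (intro convexD[OF convex_ball]) (auto simp: dist_commute)
    then show "(1 - b) *\<^sub>R p + b *\<^sub>R p0 \<in> closure \<Omega>"
      using r closure_subset by blast
  qed
next
  case False
  then have "p0 \<in> frontier \<Omega>"
    using assms by (simp add: frontier_def interior_open)
  then obtain N \<rho> g where "local_defining_function \<Omega> p0 N \<rho> g"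
    using assms(2) by (auto simp: C2_boundary_def)
  then have N: "open N" "p0 \<in> N" "g p0 \<noteq> 0"
      and \<rho>: "\<And>x. x \<in> N \<Longrightarrow> (\<rho> has_derivative (\<lambda>h. h \<bullet> g x)) (at x)"
      and inside: "\<Omega> \<inter> N = {x\<in>N. \<rho> x < 0}" and bdry: "frontier \<Omega> \<inter> N = {x\<in>N. \<rho> x = 0}"
      and "isCont g p0"
    by (auto simp: local_defining_function_def C2_with_gradient_on_def gderiv_def
        dest!: bspec intro: has_derivative_continuous)
  define a where "a = g p0"
  have a: "norm a > 0" using N by (simp add: a_def)
  obtain e1 where e1: "e1 > 0" "\<And>x. dist x p0 < e1 \<Longrightarrow> dist (g x) a < norm a / 2"
    using \<open>isCont g p0\<close> a unfolding continuous_at_eps_delta a_def by (metis half_gt_zero)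
  obtain e2 where e2: "e2 > 0" "ball p0 e2 \<subseteq> N"
    using N open_contains_ball by blast
  define e where "e = min e1 e2"
  have e: "e > 0" "ball p0 e \<subseteq> N" using e1 e2 by (auto simp: e_def)
  define y where "y = p0 - (e / (2 * norm a)) *\<^sub>R a"
  have y: "y \<in> ball p0 e" using a e by (simp add: y_def dist_norm)
  have in_cl: "x \<in> closure \<Omega> \<longleftrightarrow> \<rho> x \<le> 0" if "x \<in> N" for x
  proof -
    have "x \<in> closure \<Omega> \<longleftrightarrow> x \<in> \<Omega> \<or> x \<in> frontier \<Omega>"
      using assms(1) closure_subset by (auto simp: frontier_def interior_open)
    moreover have "x \<in> \<Omega> \<longleftrightarrow> \<rho> x < 0" "x \<in> frontier \<Omega> \<longleftrightarrow> \<rho> x = 0"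
      using that inside bdry by blast+
    ultimately show ?thesis by auto
  qed
  (* Points within e/8 of p0 deviate too little to compensate the displacement of y, of length e/2. *)
  have neg: "(y - p) \<bullet> g x \<le> 0" if p: "dist p p0 < e / 8" and x: "dist x p0 < e" for p x
  proof -
    have d: "norm (g x - a) < norm a / 2"
      using e1(2)[of x] x by (simp add: e_def dist_norm)
    have n: "norm (g x) \<le> 2 * norm a"
      using norm_triangle_sub[of "g x" a] d a by linarith
    have "\<bar>a \<bullet> (g x - a)\<bar> \<le> norm a * (norm a / 2)"
      using Cauchy_Schwarz_ineq2[of a "g x - a"] d a
      by (meson less_imp_le mult_left_mono norm_ge_zero order_trans)
    moreover have "a \<bullet> g x = norm a * norm a + a \<bullet> (g x - a)"
      by (simp add: inner_diff_right power2_norm_eq_inner flip: power2_eq_square)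
    ultimately have ag: "a \<bullet> g x \<ge> norm a * norm a / 2" by simp
    have "(p0 - p) \<bullet> g x \<le> norm (p0 - p) * norm (g x)"
      by (rule norm_cauchy_schwarz)
    also have "\<dots> \<le> e / 8 * (2 * norm a)"
      using p n e by (intro mult_mono) (auto simp: dist_norm norm_minus_commute)
    finally have 1: "(p0 - p) \<bullet> g x \<le> e * norm a / 4" by simp
    have "e / (2 * norm a) * (a \<bullet> g x) \<ge> e / (2 * norm a) * (norm a * norm a / 2)"
      using ag a e by (intro mult_left_mono) auto
    also have "e / (2 * norm a) * (norm a * norm a / 2) = e * norm a / 4"
      using a by (simp add: field_simps)
    finally have 2: "e / (2 * norm a) * (a \<bullet> g x) \<ge> e * norm a / 4" .
    have "(y - p) \<bullet> g x = (p0 - p) \<bullet> g x - e / (2 * norm a) * (a \<bullet> g x)"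
      by (simp add: y_def inner_diff_left)
    then show ?thesis using 1 2 by simp
  qed
  have star: "(1 - b) *\<^sub>R p + b *\<^sub>R y \<in> closure \<Omega>"
    if p: "p \<in> closure \<Omega>" "dist p p0 < e / 8" and b: "0 \<le> b" "b \<le> 1" for p b
  proof -
    have pe: "p \<in> ball p0 e" using p e by (simp add: dist_commute)
    define c where "c = (\<lambda>s. p + s *\<^sub>R (y - p))"
    have c_ball: "c s \<in> ball p0 e" if "0 \<le> s" "s \<le> 1" for s
    proof -
      have "(1 - s) *\<^sub>R p + s *\<^sub>R y \<in> ball p0 e"
        using that pe y by (intro convexD[OF convex_ball]) auto
      then show ?thesis by (simp add: c_def algebra_simps)
    qed
    have "(\<rho> \<circ> c) b \<le> (\<rho> \<circ> c) 0"
    proof (rule DERIV_nonpos_imp_nonincreasing[OF b(1)])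
      fix s assume s: "0 \<le> s" "s \<le> b"
      have cs: "c s \<in> ball p0 e" using c_ball s b by auto
      have "(c has_derivative (\<lambda>h. h *\<^sub>R (y - p))) (at s)"
        unfolding c_def by (auto intro!: derivative_eq_intros)
      then have "((\<rho> \<circ> c) has_derivative (\<lambda>h. (h *\<^sub>R (y - p)) \<bullet> g (c s))) (at s)"
        using has_derivative_compose[of c "\<lambda>h. h *\<^sub>R (y - p)" s UNIV \<rho> "\<lambda>h. h \<bullet> g (c s)"] \<rho>[of "c s"] cs e
        unfolding o_def by blast
      then have "DERIV (\<rho> \<circ> c) s :> (y - p) \<bullet> g (c s)"
        by (simp add: has_field_derivative_def mult_commute_abs)
      then show "\<exists>y. DERIV (\<rho> \<circ> c) s :> y \<and> y \<le> 0"
        using neg[OF p(2), of "c s"] cs by (auto simp: dist_commute)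
    qed
    moreover have "\<rho> p \<le> 0" using in_cl p pe e by blast
    ultimately have "\<rho> (c b) \<le> 0" by (simp add: c_def)
    then have "c b \<in> closure \<Omega>" using in_cl c_ball[OF b] e by blast
    then show ?thesis by (simp add: c_def algebra_simps)
  qed
  show thesis
  proof
    show "y \<in> closure \<Omega>" using star[of p0 1] assms e by simp
    show "e / 8 > 0" using e by simp
  qed (use star in blast)
qed

section \<open>Monotone pairs over a fixed base point\<close>

text \<open>
  A one-sided bound that holds although \<open>F\<close> and \<open>G\<close> can be unbounded. Comparing \<open>(q,u)\<close> with \<open>(y,v)\<close>
  gives it with \<open>v\<close> in place of \<open>w\<close>. Among the vertices \<open>v\<close> of the cube containing all \<open>w\<close> there
  is one with \<open>\<langle>F(q,u), v\<rangle> \<ge> \<langle>F(q,u), w\<rangle>\<close>, so finitely many values of \<open>F\<close> and \<open>G\<close> at \<open>y\<close>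
  determine the constant.
\<close>

lemma monotone_pair_lower_bound:
  fixes F G :: "'a::euclidean_space \<Rightarrow> 'a \<Rightarrow> 'a"
  assumes mono: "monotone_pair_on S G F" and "bounded S" and y: "y \<in> S"
  obtains C where "\<And>q (u::'a) (w::'a). q \<in> S \<Longrightarrow> norm u \<le> M \<Longrightarrow> norm w \<le> M \<Longrightarrow>
      G q u \<bullet> (q - y) + F q u \<bullet> (u - w) \<ge> - C"
proof -
  obtain B where B: "\<And>q. q \<in> S \<Longrightarrow> norm (q - y) \<le> B"
    using bounded_translation_minus[OF assms(2), of y] unfolding bounded_iff by auto
  define vertex where "vertex = (\<lambda>A::'a set. \<Sum>b\<in>Basis. (if b \<in> A then M else - M) *\<^sub>R b)"
  define K where "K = vertex ` Pow Basis"
  have "finite K" by (simp add: K_def)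
  define c where "c = (\<lambda>v. norm (G y v) * B + norm (F y v) * (M + norm v))"
  show thesis
  proof
    fix q and u w :: 'a
    assume q: "q \<in> S" and u: "norm u \<le> M" and w: "norm w \<le> M"
    have M: "M \<ge> 0" using u norm_ge_zero[of u] by linarith
    have B0: "B \<ge> 0" using B[OF y] by simp
    define v where "v = vertex {b\<in>Basis. F q u \<bullet> b \<ge> 0}"
    have v: "v \<in> K" by (auto simp: v_def K_def)
    have vb: "v \<bullet> b = (if F q u \<bullet> b \<ge> 0 then M else - M)" if "b \<in> Basis" for b
      using that by (simp add: v_def vertex_def)
    have "F q u \<bullet> (v - w) = (\<Sum>b\<in>Basis. (F q u \<bullet> b) * ((v - w) \<bullet> b))"
      by (rule euclidean_inner)
    also have "\<dots> \<ge> 0"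
    proof (rule sum_nonneg)
      fix b :: 'a assume b: "b \<in> Basis"
      have "\<bar>w \<bullet> b\<bar> \<le> M" using Basis_le_norm[OF b, of w] w by simp
      then show "0 \<le> (F q u \<bullet> b) * ((v - w) \<bullet> b)"
        using vb[OF b] by (auto simp: inner_diff_left zero_le_mult_iff)
    qed
    finally have 1: "F q u \<bullet> (v - w) \<ge> 0" .
    have 2: "(G q u - G y v) \<bullet> (q - y) + (F q u - F y v) \<bullet> (u - v) \<ge> 0"
      using mono q y by (auto simp: monotone_pair_on_def)
    have 3: "\<bar>G y v \<bullet> (q - y)\<bar> \<le> norm (G y v) * B"
      using Cauchy_Schwarz_ineq2 B[OF q] by (meson mult_left_mono norm_ge_zero order_trans)
    have "norm (u - v) \<le> M + norm v" using norm_triangle_ineq4[of u v] u by linarith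
    then have 4: "\<bar>F y v \<bullet> (u - v)\<bar> \<le> norm (F y v) * (M + norm v)"
      using Cauchy_Schwarz_ineq2 by (meson mult_left_mono norm_ge_zero order_trans)
    have "c v \<le> sum c K"
      using v \<open>finite K\<close> M B0 by (intro member_le_sum) (auto simp: c_def)
    then show "G q u \<bullet> (q - y) + F q u \<bullet> (u - w) \<ge> - sum c K"
      using 1 2 3 4 by (simp add: c_def inner_diff_left inner_diff_right)
  qed
qed

section \<open>Perturbed minimisation on compact sets\<close>

text \<open>
  The perturbation selects a prescribed minimum point \<open>x0\<close> whatever the bounded part \<open>\<Psi>\<close> is: on the
  ball of radius \<open>\<bar>x0\<bar>\<close>, which contains all minimum points of \<open>f\<close>, the distance from \<open>-x0\<close> is
  largest at \<open>x0\<close> only, quantitatively by the parallelogram identity. Hence a large \<open>L\<close> outweighs \<open>\<Psi>\<close>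
  at minimum points away from \<open>x0\<close>, and a small \<open>\<beta>\<close> cannot make up for the gap of \<open>f\<close> elsewhere.
\<close>

lemma concave_perturbation_localizes:
  fixes f \<Psi> :: "'e::real_inner \<Rightarrow> real"
  assumes X: "compact X" and f: "continuous_on X f" and \<Psi>: "continuous_on X \<Psi>"
    and x0: "x0 \<in> X" and min: "\<And>x. x \<in> X \<Longrightarrow> f x0 \<le> f x"
    and far: "\<And>x. x \<in> X \<Longrightarrow> f x = f x0 \<Longrightarrow> norm x \<le> norm x0"
    and "r > 0"
  obtains L \<beta>0 where "L > 0" "\<beta>0 > 0"
    "\<And>\<beta>. 0 < \<beta> \<Longrightarrow> \<beta> < \<beta>0 \<Longrightarrow> \<exists>x\<in>X. dist x x0 < r \<and>
       (\<forall>x'\<in>X. f x + \<beta> * (\<Psi> x - L * (norm (x + x0))\<^sup>2)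
             \<le> f x' + \<beta> * (\<Psi> x' - L * (norm (x' + x0))\<^sup>2))"
proof -
  have "bounded (\<Psi> ` X)" using X \<Psi> by (simp add: compact_continuous_image compact_imp_bounded)
  then obtain B where B: "\<And>x. x \<in> X \<Longrightarrow> \<bar>\<Psi> x\<bar> \<le> B"
    by (auto simp: bounded_iff)
  have B0: "B \<ge> 0" using B[OF x0] by simp
  define L where "L = (2 * B + 1) / r\<^sup>2"
  have L: "L > 0" "L * r\<^sup>2 = 2 * B + 1" using B0 \<open>r > 0\<close> by (auto simp: L_def)
  define h where "h = (\<lambda>x. (\<Psi> x - L * (norm (x + x0))\<^sup>2) - (\<Psi> x0 - L * (norm (x0 + x0))\<^sup>2))"
  have hcont: "continuous_on X h"
    unfolding h_def by (intro continuous_intros \<Psi>)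
  (* Away from x0, only points of M could compete with x0 in the perturbed problem. *)
  define M where "M = {x\<in>X. h x \<le> 0 \<and> r \<le> dist x x0}"
  have M: "compact M"
  proof -
    have "M = X \<inter> {x\<in>X. h x \<le> 0} \<inter> {x\<in>X. r \<le> dist x x0}" by (auto simp: M_def)
    moreover have "closed {x\<in>X. h x \<le> 0}" "closed {x\<in>X. r \<le> dist x x0}"
      by (intro continuous_on_closed_Collect_le hcont continuous_intros compact_imp_closed[OF X])+
    ultimately show ?thesis using X by (simp add: compact_Int_closed)
  qed
  have gt: "f x > f x0" if "x \<in> M" for x
  proof (rule ccontr)
    assume "\<not> f x > f x0"
    then have "norm x \<le> norm x0" using that min[of x] far[of x] by (auto simp: M_def)
    then have "(norm x)\<^sup>2 \<le> (norm x0)\<^sup>2" by (simp add: power_mono)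
    moreover have "(norm (x + x0))\<^sup>2 + (norm (x - x0))\<^sup>2 = 2 * (norm x)\<^sup>2 + 2 * (norm x0)\<^sup>2"
      "(norm (x0 + x0))\<^sup>2 = 4 * (norm x0)\<^sup>2"
      by (simp_all add: power2_norm_eq_inner inner_simps inner_commute)
    moreover have "r\<^sup>2 \<le> (norm (x - x0))\<^sup>2"
      using that \<open>r > 0\<close> by (simp add: M_def dist_norm power_mono)
    ultimately have "(norm (x0 + x0))\<^sup>2 - (norm (x + x0))\<^sup>2 \<ge> r\<^sup>2" by linarith
    then have "L * ((norm (x0 + x0))\<^sup>2 - (norm (x + x0))\<^sup>2) \<ge> 2 * B + 1"
      using L mult_left_mono[of "r\<^sup>2" _ L] by simp
    then have "h x > 0"
      using B[of x] B[OF x0] that by (auto simp: h_def M_def algebra_simps)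
    then show False using that by (simp add: M_def)
  qed
  obtain \<eta> where \<eta>: "\<eta> > 0" "\<And>x. x \<in> M \<Longrightarrow> f x \<ge> f x0 + \<eta>"
  proof (cases "M = {}")
    case True then show thesis using that[of 1] by auto
  next
    case False
    have "continuous_on M f" using f by (rule continuous_on_subset) (auto simp: M_def)
    then obtain m where "m \<in> M" "\<And>x. x \<in> M \<Longrightarrow> f m \<le> f x"
      using continuous_attains_inf[OF M False] by blast
    then show thesis using that[of "f m - f x0"] gt[of m] by auto
  qed
  have "bounded (h ` X)" using X hcont by (simp add: compact_continuous_image compact_imp_bounded)
  then obtain D where D: "D > 0" "\<And>x. x \<in> X \<Longrightarrow> \<bar>h x\<bar> \<le> D"
    by (auto simp: bounded_pos)
  show thesis
  proof
    show "L > 0" "\<eta> / D > 0" using L \<eta> D by auto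
    fix \<beta> assume \<beta>: "0 < \<beta>" "\<beta> < \<eta> / D"
    have "continuous_on X (\<lambda>x. f x + \<beta> * h x)" by (intro continuous_intros f hcont)
    then obtain x where x: "x \<in> X" "\<And>x'. x' \<in> X \<Longrightarrow> f x + \<beta> * h x \<le> f x' + \<beta> * h x'"
      using continuous_attains_inf[OF X] x0 by blast
    have "dist x x0 < r"
    proof (rule ccontr)
      assume far: "\<not> dist x x0 < r"
      have le: "f x + \<beta> * h x \<le> f x0" using x(2)[OF x0] by (simp add: h_def)
      have "h x \<le> 0"
        using le min[OF x(1)] \<beta> by (smt (verit) mult_pos_pos)
      then have "f x \<ge> f x0 + \<eta>" using \<eta> far x by (auto simp: M_def)
      moreover have "\<beta> * \<bar>h x\<bar> \<le> \<beta> * D" using D x \<beta> by (intro mult_left_mono) auto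
      moreover have "\<beta> * D < \<eta>" using \<beta> D by (simp add: field_simps)
      ultimately show False using le \<open>h x \<le> 0\<close> by (simp add: abs_if split: if_splits)
    qed
    moreover have "f x + \<beta> * (\<Psi> x - L * (norm (x + x0))\<^sup>2)
             \<le> f x' + \<beta> * (\<Psi> x' - L * (norm (x' + x0))\<^sup>2)" if "x' \<in> X" for x'
      using x(2)[OF that] by (simp add: h_def algebra_simps)
    ultimately show "\<exists>x\<in>X. dist x x0 < r \<and>
       (\<forall>x'\<in>X. f x + \<beta> * (\<Psi> x - L * (norm (x + x0))\<^sup>2)
             \<le> f x' + \<beta> * (\<Psi> x' - L * (norm (x' + x0))\<^sup>2))" using x(1) by blast
  qed
qed

text \<open>
  The gap between a strictly concave quadratic and its tangent is what makes the minimum strict.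
\<close>

lemma concave_perturbation_strict:
  fixes H :: "'e::real_inner \<Rightarrow> real"
  assumes min: "H x - c * (norm (x + x0))\<^sup>2 \<le> H x' - c * (norm (x' + x0))\<^sup>2"
    and "c > 0" "x' \<noteq> x"
  shows "H x - 2 * c * ((x + x0) \<bullet> x) < H x' - 2 * c * ((x + x0) \<bullet> x')"
proof -
  have "(norm (x' + x0))\<^sup>2 = (norm (x + x0))\<^sup>2 + 2 * ((x + x0) \<bullet> (x' - x)) + (norm (x' - x))\<^sup>2"
    by (simp add: power2_norm_eq_inner inner_simps inner_commute)
  then have "c * (norm (x' + x0))\<^sup>2
      = c * (norm (x + x0))\<^sup>2 + 2 * c * ((x + x0) \<bullet> x') - 2 * c * ((x + x0) \<bullet> x) + c * (norm (x' - x))\<^sup>2"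
    by (simp only: inner_diff_right) (simp add: distrib_left right_diff_distrib)
  moreover have "c * (norm (x' - x))\<^sup>2 > 0" using assms by simp
  ultimately show ?thesis using min by linarith
qed

lemma compact_large_penalty:
  fixes g d :: "'e::topological_space \<Rightarrow> real"
  assumes Y: "compact Y" and g: "continuous_on Y g" and d: "continuous_on Y d"
    and pos: "\<And>x. x \<in> Y \<Longrightarrow> d x > 0"
  obtains k where "k > 0" "\<And>x. x \<in> Y \<Longrightarrow> g x + k * d x > c"
proof (cases "Y = {}")
  case True then show thesis using that[of 1] by simp
next
  case False
  obtain m where m: "m \<in> Y" "\<And>x. x \<in> Y \<Longrightarrow> d m \<le> d x"
    using continuous_attains_inf[OF Y False d] by blast
  have dm: "d m > 0" using pos m by blast
  have "bounded (g ` Y)" using Y g by (simp add: compact_continuous_image compact_imp_bounded)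
  then obtain B where B: "\<And>x. x \<in> Y \<Longrightarrow> \<bar>g x\<bar> \<le> B"
    by (auto simp: bounded_iff)
  have B0: "B \<ge> 0" using B[OF m(1)] by simp
  define k where "k = (B + \<bar>c\<bar> + 1) / d m"
  have k: "k > 0" "k * d m = B + \<bar>c\<bar> + 1" using B0 dm by (auto simp: k_def)
  show thesis
  proof (rule that[OF k(1)])
    fix x assume x: "x \<in> Y"
    have "k * d x \<ge> B + \<bar>c\<bar> + 1" using k m(2)[OF x] by (metis mult_left_mono less_imp_le)
    then show "g x + k * d x > c" using B[OF x] by linarith
  qed
qed

section \<open>Test inequalities\<close>

lemma M_solution_quadratic_test:
  assumes U: "M_solution \<Omega> F G U" and t: "0 < t" "t \<le> T" and q: "q \<in> closure \<Omega>" "p \<in> closure \<Omega>"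
    and min: "\<And>t' q'. 0 \<le> t' \<Longrightarrow> t' \<le> T \<Longrightarrow> q' \<in> closure \<Omega> \<Longrightarrow> (t', q') \<noteq> (t, q) \<Longrightarrow>
      (U t q - V) \<bullet> (q - p) + k * (t - s)\<^sup>2 - \<kappa> * t
        < (U t' q' - V) \<bullet> (q' - p) + k * (t' - s)\<^sup>2 - \<kappa> * t'"
  shows "G q (U t q) \<bullet> (q - p) + F q (U t q) \<bullet> (U t q - V) \<le> \<kappa> - 2 * k * (t - s)"
proof -
  define \<theta> where "\<theta> = (\<lambda>t. \<kappa> * t - k * (t - s)\<^sup>2)"
  have der: "DERIV \<theta> t :> \<kappa> - 2 * k * (t - s)" for t
    unfolding \<theta>_def by (auto intro!: derivative_eq_intros)
  have "\<theta> C1_differentiable_on UNIV"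
    unfolding C1_differentiable_on_def
    using der by (intro exI[of _ "\<lambda>t. \<kappa> - 2 * k * (t - s)"])
      (auto simp: has_real_derivative_iff_has_vector_derivative intro!: continuous_intros)
  moreover have "strict_min_point ({0..T} \<times> closure \<Omega>) (\<lambda>(s, x). (U s x - V) \<bullet> (x - p) - \<theta> s) (t, q)"
    using t q min by (fastforce simp: strict_min_point_def \<theta>_def)
  moreover have "T > 0" "t \<in> {0<..T}" using t by auto
  ultimately have "deriv \<theta> t \<ge> G q (U t q) \<bullet> (q - p) + F q (U t q) \<bullet> (U t q - V)"
    using U q unfolding M_solution_def by blast
  then show ?thesis using DERIV_imp_deriv[OF der] by simp
qed

text \<open>
  The space part of the tangent of the quadratic goes into the vector \<open>V\<close>, its time part into the
  slope of the test function, so a minimum perturbed by a concave quadratic can be tested without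
  knowing that it is strict.
\<close>

lemma M_solution_semiconcave_test:
  assumes U: "M_solution \<Omega> F G U" and t: "0 < t" "t \<le> T" and q: "q \<in> closure \<Omega>" "p \<in> closure \<Omega>"
    and "c > 0"
    and min: "\<And>t' q'. 0 \<le> t' \<Longrightarrow> t' \<le> T \<Longrightarrow> q' \<in> closure \<Omega> \<Longrightarrow>
      U t q \<bullet> (q - p) - v \<bullet> q + k * (t - s)\<^sup>2 + \<gamma> * t - c * (norm ((t, q) + (t0, q0)))\<^sup>2
      \<le> U t' q' \<bullet> (q' - p) - v \<bullet> q' + k * (t' - s)\<^sup>2 + \<gamma> * t' - c * (norm ((t', q') + (t0, q0)))\<^sup>2"
  shows "G q (U t q) \<bullet> (q - p) + F q (U t q) \<bullet> (U t q - (v + (2 * c) *\<^sub>R (q + q0)))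
      \<le> - \<gamma> + 2 * c * (t + t0) - 2 * k * (t - s)"
proof -
  let ?V = "v + (2 * c) *\<^sub>R (q + q0)" and ?\<kappa> = "- \<gamma> + 2 * c * (t + t0)"
  define H where "H = (\<lambda>(t, q). U t q \<bullet> (q - p) - v \<bullet> q + k * (t - s)\<^sup>2 + \<gamma> * t)"
  have linearized: "(U t' q' - ?V) \<bullet> (q' - p) + k * (t' - s)\<^sup>2 - ?\<kappa> * t'
      = H (t', q') - 2 * c * (((t, q) + (t0, q0)) \<bullet> (t', q')) + ?V \<bullet> p" for t' q'
    by (simp add: H_def inner_diff_left inner_diff_right inner_add_left ring_distribs)
  show ?thesis
  proof (rule M_solution_quadratic_test[OF U t q])
    fix t' q' assume *: "0 \<le> t'" "t' \<le> T" "q' \<in> closure \<Omega>" "(t', q') \<noteq> (t, q)"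
    have "H (t, q) - 2 * c * (((t, q) + (t0, q0)) \<bullet> (t, q))
        < H (t', q') - 2 * c * (((t, q) + (t0, q0)) \<bullet> (t', q'))"
    proof (rule concave_perturbation_strict[OF _ \<open>c > 0\<close> *(4)])
      show "H (t, q) - c * (norm ((t, q) + (t0, q0)))\<^sup>2 \<le> H (t', q') - c * (norm ((t', q') + (t0, q0)))\<^sup>2"
        using min[OF *(1-3)] by (simp only: H_def split_conv)
    qed
    then show "(U t q - ?V) \<bullet> (q - p) + k * (t - s)\<^sup>2 - ?\<kappa> * t
        < (U t' q' - ?V) \<bullet> (q' - p) + k * (t' - s)\<^sup>2 - ?\<kappa> * t'"
      unfolding linearized by linarith
  qed
qed

section \<open>Comparison of solutions\<close>

text \<open>
  The sum of the two tests at a minimum point of the doubled functional. The inner products with \<open>p - y\<close> and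
  \<open>q - z\<close> are chosen so that \<open>U\<close> and \<open>W\<close> are multiplied exactly by \<open>q - ((1-\<beta>)p + \<beta>y)\<close> and
  \<open>p - ((1-\<beta>)q + \<beta>z)\<close>. All error terms then carry the factor \<open>\<beta>\<close>, and the time penalty cancels.
\<close>

lemma doubled_minimum_slope_bound:
  fixes F G :: "'a::euclidean_space \<Rightarrow> 'a \<Rightarrow> 'a"
  assumes U: "M_solution \<Omega> F G U" and W: "M_solution \<Omega> F G W"
    and mono: "monotone_pair_on (closure \<Omega>) G F"
    and t: "0 < t" "t \<le> T" and s: "0 < s" "s \<le> T" and q: "q \<in> closure \<Omega>" and p: "p \<in> closure \<Omega>"
    and \<beta>: "0 < \<beta>" "\<beta> \<le> 1" and "L > 0"
    and p': "(1 - \<beta>) *\<^sub>R p + \<beta> *\<^sub>R y \<in> closure \<Omega>" and q': "(1 - \<beta>) *\<^sub>R q + \<beta> *\<^sub>R z \<in> closure \<Omega>"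
    and min: "\<And>t' q' s' p'. 0 \<le> t' \<Longrightarrow> t' \<le> T \<Longrightarrow> q' \<in> closure \<Omega> \<Longrightarrow> 0 \<le> s' \<Longrightarrow> s' \<le> T \<Longrightarrow> p' \<in> closure \<Omega> \<Longrightarrow>
      (U t q - W s p) \<bullet> (q - p) + k * (t - s)\<^sup>2 + \<gamma> * (t + s)
        + \<beta> * (U t q \<bullet> (p - y) + W s p \<bullet> (q - z) - L * (norm (((t, q), (s, p)) + ((t0, q0), (s0, p0))))\<^sup>2)
      \<le> (U t' q' - W s' p') \<bullet> (q' - p') + k * (t' - s')\<^sup>2 + \<gamma> * (t' + s')
        + \<beta> * (U t' q' \<bullet> (p' - y) + W s' p' \<bullet> (q' - z) - L * (norm (((t', q'), (s', p')) + ((t0, q0), (s0, p0))))\<^sup>2)"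
    and C1: "G q (U t q) \<bullet> (q - y) + F q (U t q) \<bullet> (U t q - (2 * L) *\<^sub>R (q + q0)) \<ge> - C1"
    and C2: "G p (W s p) \<bullet> (p - z) + F p (W s p) \<bullet> (W s p - (2 * L) *\<^sub>R (p + p0)) \<ge> - C2"
  shows "2 * \<gamma> \<le> \<beta> * (C1 + C2 + 2 * L * (t + t0 + s + s0))"
proof -
  let ?p = "(1 - \<beta>) *\<^sub>R p + \<beta> *\<^sub>R y" and ?q = "(1 - \<beta>) *\<^sub>R q + \<beta> *\<^sub>R z"
  have norm_split: "(norm (((a, b), c, d) + ((t0, q0), (s0, p0))))\<^sup>2
      = (norm ((a, b) + (t0, q0)))\<^sup>2 + (norm ((c, d) + (s0, p0)))\<^sup>2" for a b c d
    by (simp add: power2_norm_eq_inner)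
  have c: "\<beta> * L > 0" using \<beta> \<open>L > 0\<close> by simp
  define J where "J t' q' s' p' = (U t' q' - W s' p') \<bullet> (q' - p') + k * (t' - s')\<^sup>2 + \<gamma> * (t' + s')
        + \<beta> * (U t' q' \<bullet> (p' - y) + W s' p' \<bullet> (q' - z) - L * (norm (((t', q'), (s', p')) + ((t0, q0), (s0, p0))))\<^sup>2)" for t' q' s' p'
  have J1: "J t' q' s p = U t' q' \<bullet> (q' - ?p) - ((1 - \<beta>) *\<^sub>R W s p) \<bullet> q' + k * (t' - s)\<^sup>2 + \<gamma> * t'
        - (\<beta> * L) * (norm ((t', q') + (t0, q0)))\<^sup>2
      + (W s p \<bullet> p - \<beta> * (W s p \<bullet> z) + \<gamma> * s - (\<beta> * L) * (norm ((s, p) + (s0, p0)))\<^sup>2)" for t' q'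
    unfolding J_def norm_split
    by (simp only: inner_diff_left inner_diff_right inner_add_right inner_scaleR_left inner_scaleR_right
        ring_distribs mult_1_left mult.assoc)
  have J2: "J t q s' p' = W s' p' \<bullet> (p' - ?q) - ((1 - \<beta>) *\<^sub>R U t q) \<bullet> p' + k * (s' - t)\<^sup>2 + \<gamma> * s'
        - (\<beta> * L) * (norm ((s', p') + (s0, p0)))\<^sup>2
      + (U t q \<bullet> q - \<beta> * (U t q \<bullet> y) + \<gamma> * t - (\<beta> * L) * (norm ((t, q) + (t0, q0)))\<^sup>2)" for s' p'
    unfolding J_def norm_split power2_commute[of t s']
    by (simp only: inner_diff_left inner_diff_right inner_add_right inner_scaleR_left inner_scaleR_right
        ring_distribs mult_1_left mult.assoc)
  note J_min = min[folded J_def]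
  have I1: "G q (U t q) \<bullet> (q - ?p) + F q (U t q) \<bullet> (U t q - ((1 - \<beta>) *\<^sub>R W s p + (2 * (\<beta> * L)) *\<^sub>R (q + q0)))
      \<le> - \<gamma> + 2 * (\<beta> * L) * (t + t0) - 2 * k * (t - s)"
  proof (rule M_solution_semiconcave_test[OF U t q p' c])
    fix t' q' assume *: "0 \<le> t'" "t' \<le> T" "q' \<in> closure \<Omega>"
    show "U t q \<bullet> (q - ?p) - ((1 - \<beta>) *\<^sub>R W s p) \<bullet> q + k * (t - s)\<^sup>2 + \<gamma> * t - (\<beta> * L) * (norm ((t, q) + (t0, q0)))\<^sup>2
      \<le> U t' q' \<bullet> (q' - ?p) - ((1 - \<beta>) *\<^sub>R W s p) \<bullet> q' + k * (t' - s)\<^sup>2 + \<gamma> * t' - (\<beta> * L) * (norm ((t', q') + (t0, q0)))\<^sup>2"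
      using J_min[OF * less_imp_le[OF s(1)] s(2) p] unfolding J1 by linarith
  qed
  have I2: "G p (W s p) \<bullet> (p - ?q) + F p (W s p) \<bullet> (W s p - ((1 - \<beta>) *\<^sub>R U t q + (2 * (\<beta> * L)) *\<^sub>R (p + p0)))
      \<le> - \<gamma> + 2 * (\<beta> * L) * (s + s0) - 2 * k * (s - t)"
  proof (rule M_solution_semiconcave_test[OF W s p q' c])
    fix s' p' assume *: "0 \<le> s'" "s' \<le> T" "p' \<in> closure \<Omega>"
    show "W s p \<bullet> (p - ?q) - ((1 - \<beta>) *\<^sub>R U t q) \<bullet> p + k * (s - t)\<^sup>2 + \<gamma> * s - (\<beta> * L) * (norm ((s, p) + (s0, p0)))\<^sup>2
      \<le> W s' p' \<bullet> (p' - ?q) - ((1 - \<beta>) *\<^sub>R U t q) \<bullet> p' + k * (s' - t)\<^sup>2 + \<gamma> * s' - (\<beta> * L) * (norm ((s', p') + (s0, p0)))\<^sup>2"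
      using J_min[OF less_imp_le[OF t(1)] t(2) q *] unfolding J2 by linarith
  qed
  (* The shift of the base point and the perturbation of V leave the monotone part intact up to
     the factor 1 - beta. *)
  have split: "A \<bullet> (a - ((1 - \<beta>) *\<^sub>R b + \<beta> *\<^sub>R y)) + B \<bullet> (u - ((1 - \<beta>) *\<^sub>R w + (2 * (\<beta> * L)) *\<^sub>R e))
      = (1 - \<beta>) * (A \<bullet> (a - b) + B \<bullet> (u - w)) + \<beta> * (A \<bullet> (a - y) + B \<bullet> (u - (2 * L) *\<^sub>R e))"
    for A B a b u w e y :: 'a
    by (simp add: inner_diff_right inner_add_right algebra_simps)
  have "(1 - \<beta>) * ((G q (U t q) - G p (W s p)) \<bullet> (q - p) + (F q (U t q) - F p (W s p)) \<bullet> (U t q - W s p)) \<ge> 0"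
    using mono q p \<beta> by (intro mult_nonneg_nonneg) (auto simp: monotone_pair_on_def)
  then have "(1 - \<beta>) * (G q (U t q) \<bullet> (q - p) + F q (U t q) \<bullet> (U t q - W s p))
      + (1 - \<beta>) * (G p (W s p) \<bullet> (p - q) + F p (W s p) \<bullet> (W s p - U t q)) \<ge> 0"
    by (simp add: inner_diff_left inner_diff_right algebra_simps)
  moreover have "\<beta> * - C1 \<le> \<beta> * (G q (U t q) \<bullet> (q - y) + F q (U t q) \<bullet> (U t q - (2 * L) *\<^sub>R (q + q0)))"
    "\<beta> * - C2 \<le> \<beta> * (G p (W s p) \<bullet> (p - z) + F p (W s p) \<bullet> (W s p - (2 * L) *\<^sub>R (p + p0)))"
    using mult_left_mono[OF C1, of \<beta>] mult_left_mono[OF C2, of \<beta>] \<beta>(1) less_imp_le by blast+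
  ultimately have "\<beta> * - C1 + \<beta> * - C2 \<le> - 2 * \<gamma> + 2 * (\<beta> * L) * (t + t0) + 2 * (\<beta> * L) * (s + s0)"
    using I1[unfolded split] I2[unfolded split] by (simp add: algebra_simps)
  then show ?thesis by (simp add: algebra_simps)
qed

text \<open>
  The order of choices matters. The minimum point \<open>x0\<close> determines \<open>y\<close> and \<open>z\<close>, these determine \<open>L\<close>,
  and \<open>L\<close> determines the constants of \<open>monotone_pair_lower_bound\<close>; only then is \<open>\<beta>\<close> chosen.
\<close>

lemma M_solution_comparison:
  fixes F G :: "'a::euclidean_space \<Rightarrow> 'a \<Rightarrow> 'a"
  assumes "open \<Omega>" "bounded \<Omega>" "C2_boundary \<Omega>" and mono: "monotone_pair_on (closure \<Omega>) G F"
    and U: "M_solution \<Omega> F G U" and W: "M_solution \<Omega> F G W"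
    and init: "\<And>q p. q \<in> closure \<Omega> \<Longrightarrow> p \<in> closure \<Omega> \<Longrightarrow> (U 0 q - W 0 p) \<bullet> (q - p) \<ge> 0"
    and T: "T \<ge> 0" and q1: "q1 \<in> closure \<Omega>" and p1: "p1 \<in> closure \<Omega>"
  shows "(U T q1 - W T p1) \<bullet> (q1 - p1) \<ge> 0"
proof (rule ccontr)
  assume neg: "\<not> ?thesis"
  define \<delta> where "\<delta> = - ((U T q1 - W T p1) \<bullet> (q1 - p1)) / 2"
  have \<delta>: "\<delta> > 0" using neg by (simp add: \<delta>_def)
  have T: "T > 0" using T init[OF q1 p1] neg by (cases "T = 0") auto
  (* The drift costs at most half of the violation 2 * delta up to time T. *)
  define \<gamma> where "\<gamma> = \<delta> / (2 * T)"
  have \<gamma>: "\<gamma> > 0" using \<delta> T by (simp add: \<gamma>_def)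
  define X where "X = ({0..T} \<times> closure \<Omega>) \<times> ({0..T} \<times> closure \<Omega>)"
  have cl: "compact (closure \<Omega>)" using assms(2) by simp
  have X: "compact X" unfolding X_def by (intro compact_Times cl compact_Icc)
  define u where "u = (\<lambda>x::(real \<times> 'a) \<times> (real \<times> 'a). U (fst (fst x)) (snd (fst x)))"
  define w where "w = (\<lambda>x::(real \<times> 'a) \<times> (real \<times> 'a). W (fst (snd x)) (snd (snd x)))"
  have slab: "continuous_on ({0..T} \<times> closure \<Omega>) (\<lambda>(t, q). U t q)" if "M_solution \<Omega> F G U" for U
    using that unfolding M_solution_def by (auto elim: continuous_on_subset)
  have cont_u: "continuous_on X u"
    using continuous_on_compose2[OF slab[OF U] continuous_on_fst[OF continuous_on_id], of X]
    unfolding X_def u_def split_beta by fastforce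
  have cont_w: "continuous_on X w"
    using continuous_on_compose2[OF slab[OF W] continuous_on_snd[OF continuous_on_id], of X]
    unfolding X_def w_def split_beta by fastforce
  define g where "g = (\<lambda>x. (u x - w x) \<bullet> (snd (fst x) - snd (snd x)))"
  have cont_g: "continuous_on X g" unfolding g_def by (intro continuous_intros cont_u cont_w)

  (* Violations with one of the two times equal to zero: the initial condition excludes equal
     times there, so the penalty removes them. *)
  define Y where "Y = {x\<in>X. g x \<le> - \<delta>} \<inter> {x\<in>X. fst (fst x) * fst (snd x) \<le> 0}"
  have "closed {x\<in>X. g x \<le> - \<delta>}" "closed {x\<in>X. fst (fst x) * fst (snd x) \<le> 0}"
    by (intro continuous_on_closed_Collect_le cont_g continuous_intros compact_imp_closed[OF X])+
  then have "closed Y" by (simp add: Y_def closed_Int)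
  moreover have "X \<inter> Y = Y" by (auto simp: Y_def)
  ultimately have Y: "compact Y" using compact_Int_closed[OF X, of Y] by simp
  have gap: "(fst (fst x) - fst (snd x))\<^sup>2 > 0" if "x \<in> Y" for x
  proof -
    have "fst (fst x) \<noteq> fst (snd x)"
    proof
      assume eq: "fst (fst x) = fst (snd x)"
      then have "fst (fst x) * fst (fst x) \<le> 0" using that by (simp add: Y_def)
      then have "fst (fst x) = 0" "fst (snd x) = 0" using eq by (auto simp: mult_le_0_iff)
      then have "g x \<ge> 0" using init[of "snd (fst x)" "snd (snd x)"] that
        by (auto simp: g_def u_def w_def Y_def X_def)
      then show False using that \<delta> by (simp add: Y_def)
    qed
    then show ?thesis by simp
  qed
  have Y_cont: "continuous_on Y g" "continuous_on Y (\<lambda>x. (fst (fst x) - fst (snd x))\<^sup>2)"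
    by (rule continuous_on_subset[OF cont_g], force simp: Y_def, intro continuous_intros)
  obtain k where k: "k > 0" "\<And>x. x \<in> Y \<Longrightarrow> g x + k * (fst (fst x) - fst (snd x))\<^sup>2 > 0"
    using compact_large_penalty[OF Y Y_cont gap, where c = 0] by blast

  define f where "f = (\<lambda>x. g x + k * (fst (fst x) - fst (snd x))\<^sup>2 + \<gamma> * (fst (fst x) + fst (snd x)))"
  have cont_f: "continuous_on X f" unfolding f_def by (intro continuous_intros cont_g)
  have x1: "((T, q1), (T, p1)) \<in> X" using T q1 p1 by (simp add: X_def)
  have f1: "f ((T, q1), (T, p1)) = - \<delta>"
    using T by (simp add: f_def g_def u_def w_def \<gamma>_def \<delta>_def field_simps)
  obtain m where m: "m \<in> X" "\<And>x. x \<in> X \<Longrightarrow> f m \<le> f x"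
    using continuous_attains_inf[OF X _ cont_f] x1 by blast
  define K where "K = {x\<in>X. f x \<le> f m}"
  have "closed K" unfolding K_def
    by (intro continuous_on_closed_Collect_le cont_f continuous_intros compact_imp_closed[OF X])
  moreover have "X \<inter> K = K" by (auto simp: K_def)
  ultimately have "compact K" using compact_Int_closed[OF X, of K] by simp
  moreover have "m \<in> K" using m by (simp add: K_def)
  ultimately obtain x0 where x0: "x0 \<in> K" "\<And>x. x \<in> K \<Longrightarrow> norm x \<le> norm x0"
    using continuous_attains_sup[OF _ _ continuous_on_norm[OF continuous_on_id], of K] by blast
  obtain t0 q0 s0 p0 where x0_eq: "x0 = ((t0, q0), (s0, p0))" by (metis prod.exhaust)
  have x0X: "x0 \<in> X" and x0_min: "\<And>x. x \<in> X \<Longrightarrow> f x0 \<le> f x"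
    using x0 m by (auto simp: K_def intro: order_trans)
  have x0_far: "norm x \<le> norm x0" if "x \<in> X" "f x = f x0" for x
    using x0 that by (auto simp: K_def)
  have mem0: "0 \<le> t0" "t0 \<le> T" "0 \<le> s0" "s0 \<le> T" "q0 \<in> closure \<Omega>" "p0 \<in> closure \<Omega>"
    using x0X by (auto simp: X_def x0_eq)
  have pos0: "t0 > 0" "s0 > 0"
  proof -
    have le: "f x0 \<le> - \<delta>" using x0_min[OF x1] f1 by simp
    have "\<gamma> * (t0 + s0) \<ge> 0" using \<gamma> mem0 by simp
    then have le2: "g x0 + k * (t0 - s0)\<^sup>2 \<le> - \<delta>" using le by (simp add: f_def x0_eq)
    moreover have "k * (t0 - s0)\<^sup>2 \<ge> 0" using k by simp
    ultimately have "g x0 \<le> - \<delta>" by linarith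
    then have "\<not> t0 * s0 \<le> 0" using k(2)[of x0] le2 \<delta> x0X by (auto simp: Y_def x0_eq)
    then show "t0 > 0" "s0 > 0" using mem0 by (auto simp: mult_le_0_iff)
  qed
  obtain y r1 where y: "y \<in> closure \<Omega>" "r1 > 0"
    "\<And>p b. p \<in> closure \<Omega> \<Longrightarrow> dist p p0 < r1 \<Longrightarrow> 0 \<le> b \<Longrightarrow> b \<le> 1 \<Longrightarrow> (1 - b) *\<^sub>R p + b *\<^sub>R y \<in> closure \<Omega>"
    using C2_boundary_locally_starshaped[OF assms(1,3) mem0(6)] by blast
  obtain z r2 where z: "z \<in> closure \<Omega>" "r2 > 0"
    "\<And>p b. p \<in> closure \<Omega> \<Longrightarrow> dist p q0 < r2 \<Longrightarrow> 0 \<le> b \<Longrightarrow> b \<le> 1 \<Longrightarrow> (1 - b) *\<^sub>R p + b *\<^sub>R z \<in> closure \<Omega>"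
    using C2_boundary_locally_starshaped[OF assms(1,3) mem0(5)] by blast
  (* Within r of x0 the times stay positive and the shifted base points stay in the domain. *)
  define r where "r = min (min r1 r2) (min t0 s0)"
  have r: "r > 0" using y z pos0 by (simp add: r_def)
  define \<Psi> where "\<Psi> = (\<lambda>x. u x \<bullet> (snd (snd x) - y) + w x \<bullet> (snd (fst x) - z))"
  have cont_\<Psi>: "continuous_on X \<Psi>" unfolding \<Psi>_def by (intro continuous_intros cont_u cont_w)
  obtain L \<beta>0 where L: "L > 0" "\<beta>0 > 0"
    "\<And>\<beta>. 0 < \<beta> \<Longrightarrow> \<beta> < \<beta>0 \<Longrightarrow> \<exists>x\<in>X. dist x x0 < r \<and>
       (\<forall>x'\<in>X. f x + \<beta> * (\<Psi> x - L * (norm (x + x0))\<^sup>2)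
             \<le> f x' + \<beta> * (\<Psi> x' - L * (norm (x' + x0))\<^sup>2))"
    using concave_perturbation_localizes[OF X cont_f cont_\<Psi> x0X x0_min x0_far r] by blast

  have bounded: "bounded (u ` X)" "bounded (w ` X)" "bounded (closure \<Omega>)"
    using X cont_u cont_w cl by (auto intro: compact_imp_bounded compact_continuous_image)
  obtain Bu where Bu: "\<And>x. x \<in> X \<Longrightarrow> norm (u x) \<le> Bu"
    using bounded(1) by (auto simp: bounded_iff)
  obtain Bw where Bw: "\<And>x. x \<in> X \<Longrightarrow> norm (w x) \<le> Bw"
    using bounded(2) by (auto simp: bounded_iff)
  obtain Bq where Bq: "\<And>q. q \<in> closure \<Omega> \<Longrightarrow> norm q \<le> Bq"
    using bounded(3) by (auto simp: bounded_iff)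
  (* M bounds the solutions as well as the shift of V caused by the quadratic, divided by beta. *)
  define M where "M = \<bar>Bu\<bar> + \<bar>Bw\<bar> + 2 * L * (Bq + Bq)"
  have M1: "norm ((2 * L) *\<^sub>R (q + q')) \<le> M" if "q \<in> closure \<Omega>" "q' \<in> closure \<Omega>" for q q'
  proof -
    have "norm (q + q') \<le> Bq + Bq" using Bq[OF that(1)] Bq[OF that(2)] norm_triangle_ineq[of q q'] by linarith
    then have "2 * L * norm (q + q') \<le> 2 * L * (Bq + Bq)" using L by (intro mult_left_mono) auto
    moreover have "norm ((2 * L) *\<^sub>R (q + q')) = 2 * L * norm (q + q')" using L(1) by simp
    ultimately show ?thesis unfolding M_def by linarith
  qed
  have "2 * L * (Bq + Bq) \<ge> 0" using Bq[OF q1] norm_ge_zero[of q1] L by (intro mult_nonneg_nonneg) linarith+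
  then have M2: "norm (u x) \<le> M" "norm (w x) \<le> M" if "x \<in> X" for x
    using Bu[OF that] Bw[OF that] unfolding M_def by linarith+
  obtain C1 where C1: "\<And>q u w. q \<in> closure \<Omega> \<Longrightarrow> norm u \<le> M \<Longrightarrow> norm w \<le> M \<Longrightarrow>
      G q u \<bullet> (q - y) + F q u \<bullet> (u - w) \<ge> - C1"
    using monotone_pair_lower_bound[OF mono bounded(3) y(1)] by blast
  obtain C2 where C2: "\<And>q u w. q \<in> closure \<Omega> \<Longrightarrow> norm u \<le> M \<Longrightarrow> norm w \<le> M \<Longrightarrow>
      G q u \<bullet> (q - z) + F q u \<bullet> (u - w) \<ge> - C2"
    using monotone_pair_lower_bound[OF mono bounded(3) z(1)] by blast
  define D where "D = \<bar>C1\<bar> + \<bar>C2\<bar> + 8 * L * T + 1"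
  have D: "D > 0" using L T by (simp add: D_def add_nonneg_pos)
  obtain \<beta> where \<beta>: "0 < \<beta>" "\<beta> < min (min \<beta>0 1) (2 * \<gamma> / D)"
    using dense[of 0 "min (min \<beta>0 1) (2 * \<gamma> / D)"] L(2) \<gamma> D by auto
  obtain x where x: "x \<in> X" "dist x x0 < r"
       and x_min: "\<And>x'. x'\<in>X \<Longrightarrow> f x + \<beta> * (\<Psi> x - L * (norm (x + x0))\<^sup>2)
             \<le> f x' + \<beta> * (\<Psi> x' - L * (norm (x' + x0))\<^sup>2)"
    using L(3)[of \<beta>] \<beta> by auto
  obtain t q s p where x_eq: "x = ((t, q), (s, p))" by (metis prod.exhaust)
  have mem: "0 \<le> t" "t \<le> T" "0 \<le> s" "s \<le> T" "q \<in> closure \<Omega>" "p \<in> closure \<Omega>"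
    using x(1) by (auto simp: X_def x_eq)
  have "dist (t, q) (t0, q0) < r" "dist (s, p) (s0, p0) < r"
    using dist_fst_le[of x x0] dist_snd_le[of x x0] x(2) by (auto simp: x_eq x0_eq)
  then have near: "dist t t0 < r" "dist q q0 < r" "dist s s0 < r" "dist p p0 < r"
    using dist_fst_le[of "(t, q)" "(t0, q0)"] dist_snd_le[of "(t, q)" "(t0, q0)"]
      dist_fst_le[of "(s, p)" "(s0, p0)"] dist_snd_le[of "(s, p)" "(s0, p0)"] by auto
  have "t > 0" "s > 0" using near by (auto simp: r_def dist_real_def)
  have "2 * \<gamma> \<le> \<beta> * (C1 + C2 + 2 * L * (t + t0 + s + s0))"
  proof (rule doubled_minimum_slope_bound[OF U W mono \<open>t > 0\<close> mem(2) \<open>s > 0\<close> mem(4,5,6) \<beta>(1) _ L(1)])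
    show "\<beta> \<le> 1" using \<beta> by simp
    show "(1 - \<beta>) *\<^sub>R p + \<beta> *\<^sub>R y \<in> closure \<Omega>" "(1 - \<beta>) *\<^sub>R q + \<beta> *\<^sub>R z \<in> closure \<Omega>"
      using y(3)[of p \<beta>] z(3)[of q \<beta>] mem near \<beta> by (auto simp: r_def)
    show "- C1 \<le> G q (U t q) \<bullet> (q - y) + F q (U t q) \<bullet> (U t q - (2 * L) *\<^sub>R (q + q0))"
      using C1[OF mem(5), of "U t q"] M1[OF mem(5) mem0(5)] M2(1)[OF x(1)] by (simp add: u_def x_eq)
    show "- C2 \<le> G p (W s p) \<bullet> (p - z) + F p (W s p) \<bullet> (W s p - (2 * L) *\<^sub>R (p + p0))"
      using C2[OF mem(6), of "W s p"] M1[OF mem(6) mem0(6)] M2(2)[OF x(1)] by (simp add: w_def x_eq)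
  next
    fix t' q' s' p'
    assume "0 \<le> t'" "t' \<le> T" "q' \<in> closure \<Omega>" "0 \<le> s'" "s' \<le> T" "p' \<in> closure \<Omega>"
    then have "((t', q'), (s', p')) \<in> X" by (simp add: X_def)
    from x_min[OF this]
    show "(U t q - W s p) \<bullet> (q - p) + k * (t - s)\<^sup>2 + \<gamma> * (t + s)
        + \<beta> * (U t q \<bullet> (p - y) + W s p \<bullet> (q - z) - L * (norm (((t, q), (s, p)) + ((t0, q0), (s0, p0))))\<^sup>2)
      \<le> (U t' q' - W s' p') \<bullet> (q' - p') + k * (t' - s')\<^sup>2 + \<gamma> * (t' + s')
        + \<beta> * (U t' q' \<bullet> (p' - y) + W s' p' \<bullet> (q' - z) - L * (norm (((t', q'), (s', p')) + ((t0, q0), (s0, p0))))\<^sup>2)"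
      by (simp add: f_def g_def u_def w_def \<Psi>_def x_eq x0_eq)
  qed
  also have "\<dots> \<le> \<beta> * D"
  proof (rule mult_left_mono)
    have "2 * L * (t + t0 + s + s0) \<le> 2 * L * (4 * T)"
      using L mem mem0 by (intro mult_left_mono) auto
    then show "C1 + C2 + 2 * L * (t + t0 + s + s0) \<le> D" unfolding D_def by linarith
  qed (use \<beta> in simp)
  also have "\<dots> < 2 * \<gamma>" using \<beta> D by (simp add: field_simps)
  finally show False by simp
qed

text \<open>
  Approaching an interior point \<open>p\<close> along the direction \<open>a = \<phi>(p) - \<psi>(p)\<close> from the side \<open>p - ha\<close>
  gives \<open>\<langle>a, a\<rangle> \<le> 0\<close>; the boundary is reached by continuity.
\<close>

lemma eq_if_cross_monotone:
  fixes \<phi> \<psi> :: "'a::real_inner \<Rightarrow> 'a"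
  assumes "open \<Omega>" and "continuous_on (closure \<Omega>) \<phi>" "continuous_on (closure \<Omega>) \<psi>"
    and cross: "\<And>q p. q \<in> closure \<Omega> \<Longrightarrow> p \<in> closure \<Omega> \<Longrightarrow> (\<phi> q - \<psi> p) \<bullet> (q - p) \<ge> 0"
    and "x \<in> closure \<Omega>"
  shows "\<phi> x = \<psi> x"
proof -
  have interior: "\<phi> p - \<psi> p = 0" if p: "p \<in> \<Omega>" for p
  proof -
    define a where "a = \<phi> p - \<psi> p"
    have lim: "((\<lambda>h. p - h *\<^sub>R a) \<longlongrightarrow> p) (at_right (0::real))"
      by (auto intro!: tendsto_eq_intros)
    have ev: "\<forall>\<^sub>F h in at_right (0::real). p - h *\<^sub>R a \<in> \<Omega>"
      using topological_tendstoD[OF lim assms(1) p] .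
    have "isCont \<phi> p"
      using assms(1,2) p closure_subset continuous_on_eq_continuous_at continuous_on_subset by metis
    then have "((\<lambda>h. (\<phi> (p - h *\<^sub>R a) - \<psi> p) \<bullet> a) \<longlongrightarrow> (\<phi> p - \<psi> p) \<bullet> a) (at_right (0::real))"
      by (intro tendsto_intros isCont_tendsto_compose[OF _ lim])
    moreover have "\<forall>\<^sub>F h in at_right (0::real). (\<phi> (p - h *\<^sub>R a) - \<psi> p) \<bullet> a \<le> 0"
      using ev eventually_at_right_less[of "0::real"]
    proof eventually_elim
      case (elim h)
      then have "(\<phi> (p - h *\<^sub>R a) - \<psi> p) \<bullet> (p - h *\<^sub>R a - p) \<ge> 0"
        using p closure_subset by (intro cross) blast+
      then show ?case using elim by (simp add: mult_le_0_iff)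
    qed
    ultimately have "a \<bullet> a \<le> 0"
      unfolding a_def[symmetric] by (intro tendsto_upperbound[OF _ _ trivial_limit_at_right_real])
    then have "a = 0" using inner_gt_zero_iff[of a] by linarith
    then show ?thesis by (simp add: a_def)
  qed
  have "continuous_on (closure \<Omega>) (\<lambda>x. \<phi> x - \<psi> x)"
    using assms by (intro continuous_intros)
  from continuous_constant_on_closure[OF this interior assms(5)] show ?thesis by simp
qed

theorem theorem9p7:
  fixes \<Omega> :: "(real ^ 'd) set"
    and F G :: "real ^ 'd \<Rightarrow> real ^ 'd \<Rightarrow> real ^ 'd"
    and U0 :: "real ^ 'd \<Rightarrow> real ^ 'd"
  assumes "open \<Omega>" and "connected \<Omega>" and "\<Omega> \<noteq> {}" and "bounded \<Omega>"
    and "C2_boundary \<Omega>"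
    and "\<forall>q\<in>frontier \<Omega>. \<forall>V. F q V \<bullet> outward_unit_normal \<Omega> q \<ge> 0"
    and "monotone_pair_on (closure \<Omega>) G F"
    and "monotone_map_on (closure \<Omega>) U0"
  shows "(\<forall>U1 U2.
            M_solution \<Omega> F G U1 \<and> (\<forall>q\<in>closure \<Omega>. U1 0 q = U0 q) \<and>
            M_solution \<Omega> F G U2 \<and> (\<forall>q\<in>closure \<Omega>. U2 0 q = U0 q) \<longrightarrow>
            (\<forall>t\<ge>0. \<forall>q\<in>closure \<Omega>. U1 t q = U2 t q)) \<and>
         (\<forall>U. M_solution \<Omega> F G U \<and> (\<forall>q\<in>closure \<Omega>. U 0 q = U0 q) \<longrightarrow>
            (\<forall>t\<ge>0. monotone_map_on (closure \<Omega>) (U t)))"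
proof (intro conjI allI impI ballI)
  note comparison = M_solution_comparison[OF \<open>open \<Omega>\<close> \<open>bounded \<Omega>\<close> \<open>C2_boundary \<Omega>\<close>
      \<open>monotone_pair_on (closure \<Omega>) G F\<close>]
  have U0: "(U0 q - U0 p) \<bullet> (q - p) \<ge> 0" if "q \<in> closure \<Omega>" "p \<in> closure \<Omega>" for q p
    using \<open>monotone_map_on (closure \<Omega>) U0\<close> that by (simp add: monotone_map_on_def)
  have cont: "continuous_on (closure \<Omega>) (U t)" if "M_solution \<Omega> F G U" "t \<ge> 0" for U t
  proof -
    have "continuous_on ({0..} \<times> closure \<Omega>) (\<lambda>(t, q). U t q)"
      using that(1) unfolding M_solution_def by blast
    then have "continuous_on (closure \<Omega>) (\<lambda>q. case (t, q) of (t, q) \<Rightarrow> U t q)"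
      by (rule continuous_on_compose2) (use that(2) in \<open>auto intro!: continuous_intros\<close>)
    then show ?thesis by simp
  qed
  {
    fix U1 U2 :: "real \<Rightarrow> real ^ 'd \<Rightarrow> real ^ 'd" and t :: real and q
    assume *: "M_solution \<Omega> F G U1 \<and> (\<forall>q\<in>closure \<Omega>. U1 0 q = U0 q) \<and>
        M_solution \<Omega> F G U2 \<and> (\<forall>q\<in>closure \<Omega>. U2 0 q = U0 q)" and t: "0 \<le> t" and q: "q \<in> closure \<Omega>"
    show "U1 t q = U2 t q"
    proof (rule eq_if_cross_monotone[OF \<open>open \<Omega>\<close> _ _ _ q])
      show "continuous_on (closure \<Omega>) (U1 t)" "continuous_on (closure \<Omega>) (U2 t)"
        using cont * t by auto
      show "(U1 t q - U2 t p) \<bullet> (q - p) \<ge> 0" if "q \<in> closure \<Omega>" "p \<in> closure \<Omega>" for q p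
      proof (rule comparison[OF _ _ _ t that])
        show "(U1 0 q - U2 0 p) \<bullet> (q - p) \<ge> 0" if "q \<in> closure \<Omega>" "p \<in> closure \<Omega>" for q p
          using U0[OF that] * that by simp
      qed (use * in auto)
    qed
  }
  fix U :: "real \<Rightarrow> real ^ 'd \<Rightarrow> real ^ 'd" and t :: real
  assume *: "M_solution \<Omega> F G U \<and> (\<forall>q\<in>closure \<Omega>. U 0 q = U0 q)" and t: "0 \<le> t"
  show "monotone_map_on (closure \<Omega>) (U t)"
    unfolding monotone_map_on_def
  proof (intro ballI)
    fix q p assume qp: "q \<in> closure \<Omega>" "p \<in> closure \<Omega>"
    show "(U t q - U t p) \<bullet> (q - p) \<ge> 0"
    proof (rule comparison[OF _ _ _ t qp])
      show "(U 0 q - U 0 p) \<bullet> (q - p) \<ge> 0" if "q \<in> closure \<Omega>" "p \<in> closure \<Omega>" for q p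
        using U0[OF that] * that by simp
    qed (use * in auto)
  qed
qed

end
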